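(* Let $[\![\mathbf U,\mathbf V,\mathbf W]\!]$ be a bilinear matrix multiplication algorithm with base case $\langle M_0,K_0,N_0\rangle$ and rank $R$, with prefactor $Q$ and stability factor $E$. Suppose that $\mathbf{C}=\mathbf{A}\cdot\mathbf{B}$, where $\mathbf{A}\in\mathbb{R}^{M\times K}$ and $\mathbf{B}\in\mathbb{R}^{K\times N}$, is computed by using $L$ recursive steps of the algorithm $[\![\mathbf U,\mathbf V,\mathbf W]\!]$, with the classical algorithm used to multiply the $(M/M_0^L)\times(K/K_0^L)$ matrices by the $(K/K_0^L)\times(N/N_0^L)$ matrices at the base cases of the recursion (where $M,K,N$ are divisible by $M_0^L,K_0^L,N_0^L$ respectively). Then the computed matrix $\hat{\mathbf{C}}$ satisfies $$\|\hat{\mathbf{C}}-\mathbf{C}\|\le\left(K/K_0^L+Q\cdot L\right)\left(K/K_0^L\right)\cdot E^L\,\|\mathbf{A}\|\,\|\mathbf{B}\|\,\epsilon+O(\epsilon^2),$$ where $\|\cdot\|$ is the max-norm.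
   Context: Max-norm: $\|\mathbf X\|=\max_{i,j}|x_{ij}|$. Bilinear algorithm: a (non-commutative) bilinear algorithm $[\![\mathbf U,\mathbf V,\mathbf W]\!]$ with base case $\langle M_0,K_0,N_0\rangle$ and rank $R$ is given by real matrices $\mathbf U$ ($M_0K_0\times R$), $\mathbf V$ ($K_0N_0\times R$), $\mathbf W$ ($M_0N_0\times R$) such that, for every $M_0\times K_0$ matrix $\mathbf A$ and $K_0\times N_0$ matrix $\mathbf B$ (with entries possibly non-commuting, e.g. matrix blocks), the product $\mathbf C=\mathbf A\mathbf B$ is given by $$c_k=\sum_{r=1}^R w_{kr}m_r,\quad m_r=s_r\cdot t_r,\quad s_r=\sum_{i=1}^{M_0K_0}u_{ir}a_i,\quad t_r=\sum_{j=1}^{K_0N_0}v_{jr}b_j,\qquad k=1,\dots,M_0N_0,$$ where single indices of entries of $\mathbf A$ and $\mathbf B$ are in column-major order and single indices of entries of $\mathbf C$ are in row-major order. Recursive (stationary) algorithm: one recursive step partitions $\mathbf A$ into $M_0\times K_0$ equally sized blocks and $\mathbf B$ into $K_0\times N_0$ equally sized blocks and applies the formulas above with blocks $\mathbf A_i,\mathbf B_j,\mathbf C_k$ in place of entries, each of the $R$ block products $\mathbf M_r=\mathbf S_r\cdot\mathbf T_r$ being computed recursively by the same rule. After $L$ levels, products are computed by the classical algorithm (each output entry is an inner product accumulated by sequential summation). Arithmetic model: each scalar operation is computed with relative error less than $\epsilon$ (machine precision), i.e. the computed value of $\mathrm{op}(a,b)$ is $\mathrm{op}(a,b)(1+\theta)$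 with $|\theta|<\epsilon$; this includes multiplications by entries of $\mathbf U,\mathbf V,\mathbf W$. All sums (over terms with nonzero coefficients) are accumulated one term at a time in sequential order. A hat denotes a computed quantity. The term $O(\epsilon^2)$ is as $\epsilon\to0$ and hides dependence on dimensions, the algorithm, and the norms of the input matrices. Principal quantities: with $\mathbb I$ the indicator function, $$\alpha_r=\sum_{i}\mathbb I(u_{ir}\ne0),\quad \beta_r=\sum_j\mathbb I(v_{jr}\neq0),\quad \gamma_k=\sum_{r=1}^R\mathbb I(w_{kr}\ne0),\quad a_r=\sum_i|u_{ir}|,\quad b_r=\sum_j|v_{jr}|.$$ The prefactor is $Q=\max_k q_k$ with $q_k=\gamma_k+\max_r(\alpha_r+\beta_r)\,\mathbb I(w_{kr}\neq0)$. The stability factor is $E=\max_k e_k$ with $e_k=\sum_{r=1}^R a_r\, b_r\,|w_{kr}|$. Here $k$ ranges over $1,\dots,M_0N_0$. *)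

theory Defs
  imports "Jordan_Normal_Form.Matrix" "HOL-Library.Landau_Symbols"
begin

text \<open>Matrices are 0-based and carry their dimensions.  The maximum is taken over the empty set
  for matrices without entries, so the norm is meaningful for positive dimensions only.\<close>

definition max_norm :: "real mat \<Rightarrow> real" where
  "max_norm X = Max (abs ` elements_mat X)"

section \<open>Blocks\<close>

definition block :: "nat \<Rightarrow> nat \<Rightarrow> real mat \<Rightarrow> nat \<Rightarrow> nat \<Rightarrow> real mat" where
  "block p q X I J = mat p q (\<lambda>(x, y). X $$ (I * p + x, J * q + y))"

text \<open>Single block indices: column-major order in a grid with \<open>m\<close> block rows, and
  row-major order in a grid with \<open>n\<close> block columns.\<close>

definition block_col_major :: "nat \<Rightarrow> nat \<Rightarrow> nat \<Rightarrow> real mat \<Rightarrow> nat \<Rightarrow> real mat" where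
  "block_col_major m p q X i = block p q X (i mod m) (i div m)"

definition block_row_major :: "nat \<Rightarrow> nat \<Rightarrow> nat \<Rightarrow> real mat \<Rightarrow> nat \<Rightarrow> real mat" where
  "block_row_major n p q X k = block p q X (k div n) (k mod n)"

section \<open>Bilinear algorithms\<close>

text \<open>The \<open>p \<times> q\<close> matrix $\sum_{i<n} c_i X_i$.\<close>

definition lin_comb :: "nat \<Rightarrow> nat \<Rightarrow> nat \<Rightarrow> (nat \<Rightarrow> real) \<Rightarrow> (nat \<Rightarrow> real mat) \<Rightarrow> real mat" where
  "lin_comb p q n c X = mat p q (\<lambda>(x, y). \<Sum>i<n. c i * X i $$ (x, y))"

text \<open>The entries on which the algorithm operates are real matrix blocks of arbitrary (compatible)
  sizes, hence in general non-commuting; scalar entries are the case \<open>p = q = s = 1\<close>.\<close>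

definition bilinear_algorithm ::
  "nat \<Rightarrow> nat \<Rightarrow> nat \<Rightarrow> nat \<Rightarrow> real mat \<Rightarrow> real mat \<Rightarrow> real mat \<Rightarrow> bool" where
  "bilinear_algorithm M0 K0 N0 R U V W \<longleftrightarrow>
     0 < M0 \<and> 0 < K0 \<and> 0 < N0 \<and>
     U \<in> carrier_mat (M0 * K0) R \<and> V \<in> carrier_mat (K0 * N0) R \<and> W \<in> carrier_mat (M0 * N0) R \<and>
     (\<forall>p q s. \<forall>A \<in> carrier_mat (M0 * p) (K0 * q). \<forall>B \<in> carrier_mat (K0 * q) (N0 * s).
        let S = (\<lambda>r. lin_comb p q (M0 * K0) (\<lambda>i. U $$ (i, r)) (block_col_major M0 p q A));
            T = (\<lambda>r. lin_comb q s (K0 * N0) (\<lambda>j. V $$ (j, r)) (block_col_major K0 q s B))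
        in \<forall>k < M0 * N0. block_row_major N0 p s (A * B) k =
             lin_comb p s R (\<lambda>r. W $$ (k, r)) (\<lambda>r. S r * T r))"

section \<open>Prefactor and stability factor\<close>

definition col_nonzeros :: "real mat \<Rightarrow> nat \<Rightarrow> nat" where
  "col_nonzeros X r = (\<Sum>i<dim_row X. of_bool (X $$ (i, r) \<noteq> 0))"

definition row_nonzeros :: "real mat \<Rightarrow> nat \<Rightarrow> nat" where
  "row_nonzeros X k = (\<Sum>r<dim_col X. of_bool (X $$ (k, r) \<noteq> 0))"

definition col_abs_sum :: "real mat \<Rightarrow> nat \<Rightarrow> real" where
  "col_abs_sum X r = (\<Sum>i<dim_row X. \<bar>X $$ (i, r)\<bar>)"

text \<open>With $\alpha_r$, $\beta_r$ the column counts of \<open>U\<close>, \<open>V\<close> and $\gamma_k$ the row counts of \<open>W\<close>: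
  $Q = \max_k (\gamma_k + \max_r (\alpha_r + \beta_r) I(w_{kr} \ne 0))$.\<close>

definition prefactor :: "real mat \<Rightarrow> real mat \<Rightarrow> real mat \<Rightarrow> nat" where
  "prefactor U V W =
     (MAX k \<in> {..<dim_row W}. row_nonzeros W k +
        (MAX r \<in> {..<dim_col W}. (col_nonzeros U r + col_nonzeros V r) * of_bool (W $$ (k, r) \<noteq> 0)))"

definition stability_factor :: "real mat \<Rightarrow> real mat \<Rightarrow> real mat \<Rightarrow> real" where
  "stability_factor U V W =
     (MAX k \<in> {..<dim_row W}. \<Sum>r<dim_col W. col_abs_sum U r * col_abs_sum V r * \<bar>W $$ (k, r)\<bar>)"

section \<open>Computation with machine precision \<open>\<epsilon>\<close>\<close>

text \<open>Rounding is a relation between exact and computed values: the relative errors of different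
  operations are independent of each other, and every outcome permitted by the model is considered.\<close>

definition rounded :: "real \<Rightarrow> real \<Rightarrow> real \<Rightarrow> bool" where
  "rounded \<epsilon> x y \<longleftrightarrow> (\<exists>\<theta>. \<bar>\<theta>\<bar> < \<epsilon> \<and> y = x * (1 + \<theta>))"

primrec fl_accumulate :: "real \<Rightarrow> real \<Rightarrow> real list \<Rightarrow> real \<Rightarrow> bool" where
  "fl_accumulate \<epsilon> acc [] s \<longleftrightarrow> s = acc"
| "fl_accumulate \<epsilon> acc (x # xs) s \<longleftrightarrow> (\<exists>acc'. rounded \<epsilon> (acc + x) acc' \<and> fl_accumulate \<epsilon> acc' xs s)"

text \<open>Summing $n \ge 1$ terms takes $n - 1$ additions: the accumulator starts with the first term.\<close>

fun fl_sum :: "real \<Rightarrow> real list \<Rightarrow> real \<Rightarrow> bool" where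
  "fl_sum \<epsilon> [] s \<longleftrightarrow> s = 0"
| "fl_sum \<epsilon> (x # xs) s \<longleftrightarrow> fl_accumulate \<epsilon> x xs s"

definition fl_sum_of_products :: "real \<Rightarrow> (real \<times> real) list \<Rightarrow> real \<Rightarrow> bool" where
  "fl_sum_of_products \<epsilon> cxs s \<longleftrightarrow>
     (\<exists>ps. list_all2 (\<lambda>(c, x) p. rounded \<epsilon> (c * x) p) cxs ps \<and> fl_sum \<epsilon> ps s)"

definition fl_lin_comb ::
  "real \<Rightarrow> nat \<Rightarrow> nat \<Rightarrow> nat \<Rightarrow> (nat \<Rightarrow> real) \<Rightarrow> (nat \<Rightarrow> real mat) \<Rightarrow> real mat \<Rightarrow> bool" where
  "fl_lin_comb \<epsilon> p q n c X S \<longleftrightarrow>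
     S \<in> carrier_mat p q \<and>
     (\<forall>x<p. \<forall>y<q. fl_sum_of_products \<epsilon> [(c i, X i $$ (x, y)). i \<leftarrow> [0..<n], c i \<noteq> 0] (S $$ (x, y)))"

definition fl_classical_product :: "real \<Rightarrow> real mat \<Rightarrow> real mat \<Rightarrow> real mat \<Rightarrow> bool" where
  "fl_classical_product \<epsilon> A B C \<longleftrightarrow>
     C \<in> carrier_mat (dim_row A) (dim_col B) \<and>
     (\<forall>x<dim_row A. \<forall>y<dim_col B.
        fl_sum_of_products \<epsilon> [(A $$ (x, l), B $$ (l, y)). l \<leftarrow> [0..<dim_col A]] (C $$ (x, y)))"

text \<open>\<open>fl_recursive_product M0 K0 N0 R U V W \<epsilon> L A B C\<close>: the matrix \<open>C\<close> is a possible computed result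
  of multiplying \<open>A\<close> and \<open>B\<close> with \<open>L\<close> recursive steps followed by classical multiplications.\<close>

primrec fl_recursive_product ::
  "nat \<Rightarrow> nat \<Rightarrow> nat \<Rightarrow> nat \<Rightarrow> real mat \<Rightarrow> real mat \<Rightarrow> real mat \<Rightarrow> real \<Rightarrow>
   nat \<Rightarrow> real mat \<Rightarrow> real mat \<Rightarrow> real mat \<Rightarrow> bool" where
  "fl_recursive_product M0 K0 N0 R U V W \<epsilon> 0 A B C \<longleftrightarrow> fl_classical_product \<epsilon> A B C"
| "fl_recursive_product M0 K0 N0 R U V W \<epsilon> (Suc L) A B C \<longleftrightarrow>
     C \<in> carrier_mat (dim_row A) (dim_col B) \<and>
     (let p = dim_row A div M0; q = dim_col A div K0; s = dim_col B div N0
      in \<exists>S T P.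
           (\<forall>r<R. fl_lin_comb \<epsilon> p q (M0 * K0) (\<lambda>i. U $$ (i, r)) (block_col_major M0 p q A) (S r) \<and>
                  fl_lin_comb \<epsilon> q s (K0 * N0) (\<lambda>j. V $$ (j, r)) (block_col_major K0 q s B) (T r) \<and>
                  fl_recursive_product M0 K0 N0 R U V W \<epsilon> L (S r) (T r) (P r)) \<and>
           (\<forall>k<M0 * N0. fl_lin_comb \<epsilon> p s R (\<lambda>r. W $$ (k, r)) P (block_row_major N0 p s C k)))"

end

theory Submission imports Defs "HOL-Real_Asymp.Real_Asymp" begin

text \<open>With \<open>u = 1 + \<epsilon>\<close> and \<open>n = K / K0 ^ L\<close>, the error obeys the closed bound
  \<open>n * E ^ L * (u ^ (Q * L + n) - 1) * \<parallel>A\<parallel> * \<parallel>B\<parallel>\<close> for every \<open>\<epsilon> > 0\<close>, by induction on \<open>L\<close>: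
  a sum of \<open>l\<close> products is computed with error at most \<open>u ^ l - 1\<close> relative to the sum of absolute
  values, and these factors multiply along the levels of the recursion.  The only
  other ingredient is \<open>K0 \<le> E\<close>, obtained by applying the algorithm to all-ones matrices; it bounds the
  inner dimension \<open>n * K0 ^ L\<close> of the exact block products by \<open>n * E ^ L\<close>.  The difference between
  the closed bound and its linear part in \<open>\<epsilon>\<close> is the quadratic remainder.\<close>

section \<open>Rounding errors of sums\<close>

lemma rounded_error:
  assumes "rounded \<epsilon> x y"
  shows "\<bar>y - x\<bar> \<le> \<epsilon> * \<bar>x\<bar>" and "\<bar>y\<bar> \<le> (1 + \<epsilon>) * \<bar>x\<bar>"
proof -
  from assms obtain \<theta> where \<theta>: "\<bar>\<theta>\<bar> < \<epsilon>" "y = x * (1 + \<theta>)"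
    unfolding rounded_def by blast
  have "y - x = \<theta> * x" using \<theta>(2) by (simp add: algebra_simps)
  then have "\<bar>y - x\<bar> = \<bar>\<theta>\<bar> * \<bar>x\<bar>" by (simp add: abs_mult)
  also have "\<dots> \<le> \<epsilon> * \<bar>x\<bar>" using \<theta>(1) by (intro mult_right_mono) auto
  finally show *: "\<bar>y - x\<bar> \<le> \<epsilon> * \<bar>x\<bar>" .
  then show "\<bar>y\<bar> \<le> (1 + \<epsilon>) * \<bar>x\<bar>" by (simp add: algebra_simps)
qed

text \<open>Each term passes through at most \<open>length xs\<close> additions, each contributing
  one factor 1 + \<theta>. Cancellation rules out a bound relative to the exact sum, so the error is
  measured against the sum of absolute values.\<close>

lemma fl_accumulate_error:
  assumes "0 < \<epsilon>" "fl_accumulate \<epsilon> acc xs s"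
  shows "\<bar>s - (acc + sum_list xs)\<bar>
    \<le> ((1 + \<epsilon>) ^ length xs - 1) * (\<bar>acc\<bar> + sum_list (map abs xs))"
  using assms(2)
proof (induction xs arbitrary: acc)
  case Nil
  then show ?case by simp
next
  case (Cons x xs)
  then obtain acc' where r: "rounded \<epsilon> (acc + x) acc'" and f: "fl_accumulate \<epsilon> acc' xs s"
    by auto
  let ?v = "(1 + \<epsilon>) ^ length xs" and ?t = "sum_list (map abs xs)" and ?z = "\<bar>acc\<bar> + \<bar>x\<bar>"
  have v: "1 \<le> ?v" using assms(1) by simp
  have t: "0 \<le> ?t" by (rule sum_list_nonneg) auto
  have z: "\<bar>acc + x\<bar> \<le> ?z" by simp
  have d: "\<bar>acc' - (acc + x)\<bar> \<le> \<epsilon> * ?z"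
    using rounded_error(1)[OF r] mult_left_mono[OF z, of \<epsilon>] assms(1) by linarith
  have "\<bar>acc'\<bar> \<le> (1 + \<epsilon>) * ?z"
    using rounded_error(2)[OF r] mult_left_mono[OF z, of "1 + \<epsilon>"] assms(1) by linarith
  then have "(?v - 1) * (\<bar>acc'\<bar> + ?t) \<le> (?v - 1) * ((1 + \<epsilon>) * ?z + ?t)"
    using v by (intro mult_left_mono) auto
  then have "\<bar>s - (acc' + sum_list xs)\<bar> \<le> (?v - 1) * ((1 + \<epsilon>) * ?z + ?t)"
    using Cons.IH[OF f] by linarith
  then have "\<bar>s - (acc + sum_list (x # xs))\<bar> \<le> (?v - 1) * ((1 + \<epsilon>) * ?z + ?t) + \<epsilon> * ?z"
    using d abs_triangle_ineq[of "s - (acc' + sum_list xs)" "acc' - (acc + x)"]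
    by (simp add: algebra_simps)
  \<comment> \<open>The coefficients of \<open>?z\<close> agree on both sides; for \<open>?t\<close>
    the right side is larger by \<epsilon> * \<open>?v\<close> * \<open>?t\<close>.\<close>
  also have "\<dots> \<le> ((1 + \<epsilon>) * ?v - 1) * (?z + ?t)"
    using mult_nonneg_nonneg[OF mult_nonneg_nonneg[of \<epsilon> ?v] t] assms(1) v
    by (simp add: algebra_simps)
  finally show ?case by (simp add: algebra_simps)
qed

text \<open>One rounding per product. The second bound is there because the summation error is
  relative to the computed products, not the exact ones.\<close>

lemma list_all2_rounded_error:
  assumes "0 < \<epsilon>" "list_all2 (\<lambda>(c, x) p. rounded \<epsilon> (c * x) p) cxs ps"
  shows "\<bar>sum_list ps - sum_list (map (\<lambda>(c, x). c * x) cxs)\<bar>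
           \<le> \<epsilon> * sum_list (map (\<lambda>(c, x). \<bar>c\<bar> * \<bar>x\<bar>) cxs)"
    and "sum_list (map abs ps) \<le> (1 + \<epsilon>) * sum_list (map (\<lambda>(c, x). \<bar>c\<bar> * \<bar>x\<bar>) cxs)"
  using assms(2)
proof (induction cxs ps rule: list_all2_induct)
  case (Cons cx cxs p ps)
  obtain c x where cx: "cx = (c, x)" by (cases cx)
  with Cons have r: "rounded \<epsilon> (c * x) p" by simp
  {
    case 1
    show ?case using rounded_error(1)[OF r] Cons(3) by (simp add: cx distrib_left abs_mult)
  next
    case 2
    show ?case using rounded_error(2)[OF r] Cons(4) by (simp add: cx distrib_left abs_mult)
  }
qed simp_all

text \<open>Of the \<open>length cxs\<close> rounding factors, one belongs to the multiplication and
  at most \<open>length cxs - 1\<close> to the additions.\<close>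

lemma fl_sum_of_products_error:
  assumes "0 < \<epsilon>" "fl_sum_of_products \<epsilon> cxs s"
  shows "\<bar>s - sum_list (map (\<lambda>(c, x). c * x) cxs)\<bar>
    \<le> ((1 + \<epsilon>) ^ length cxs - 1) * sum_list (map (\<lambda>(c, x). \<bar>c\<bar> * \<bar>x\<bar>) cxs)"
proof -
  let ?e = "sum_list (map (\<lambda>(c, x). c * x) cxs)" and ?t = "sum_list (map (\<lambda>(c, x). \<bar>c\<bar> * \<bar>x\<bar>) cxs)"
  from assms(2) obtain ps where
    ps: "list_all2 (\<lambda>(c, x) p. rounded \<epsilon> (c * x) p) cxs ps" and s: "fl_sum \<epsilon> ps s"
    unfolding fl_sum_of_products_def by blast
  have len: "length ps = length cxs" using ps by (simp add: list_all2_lengthD)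
  show ?thesis
  proof (cases ps)
    case Nil
    \<comment> \<open>The empty sum is computed exactly as 0, and the factor (1 + \<epsilon>)^0 - 1
      vanishes as well.\<close>
    then show ?thesis using len s by simp
  next
    case (Cons p ps')
    let ?v = "(1 + \<epsilon>) ^ length ps'"
    have v: "1 \<le> ?v" using assms(1) by simp
    have l: "(1 + \<epsilon>) ^ length cxs = (1 + \<epsilon>) * ?v" using len Cons by (metis length_Cons power_Suc)
    have "\<bar>s - sum_list ps\<bar> \<le> (?v - 1) * sum_list (map abs ps)"
      using fl_accumulate_error[OF assms(1), of p ps' s] s Cons by simp
    also have "\<dots> \<le> (?v - 1) * ((1 + \<epsilon>) * ?t)"
      using v list_all2_rounded_error(2)[OF assms(1) ps] by (intro mult_left_mono) auto
    finally have "\<bar>s - ?e\<bar> \<le> (?v - 1) * ((1 + \<epsilon>) * ?t) + \<epsilon> * ?t"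
      using list_all2_rounded_error(1)[OF assms(1) ps] by linarith
    also have "\<dots> = ((1 + \<epsilon>) * ?v - 1) * ?t" by (simp add: algebra_simps)
    finally show ?thesis by (simp only: l)
  qed
qed

section \<open>Linear combinations over nonzero coefficients\<close>

text \<open>Terms with zero coefficient are never computed; this is how the counts \<alpha>,
  \<beta>, \<gamma> enter as exponents.\<close>

lemma length_filtered_upt:
  "length [(c i, f i). i \<leftarrow> [0..<n], c i \<noteq> (0::real)] = (\<Sum>i<n. of_bool (c i \<noteq> 0))"
  by (induction n) auto

text \<open>The skipped terms contribute nothing. Stated for general \<open>h\<close> to cover both
  the exact sum and the sum of absolute values.\<close>

lemma sum_list_filtered_upt:
  fixes h :: "real \<times> real \<Rightarrow> real"
  assumes "\<And>x. h (0, x) = 0"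
  shows "sum_list (map h [(c i, f i). i \<leftarrow> [0..<n], c i \<noteq> 0]) = (\<Sum>i<n. h (c i, f i))"
  using assms by (induction n) auto

lemma fl_lin_comb_error:
  assumes "0 < \<epsilon>" "fl_lin_comb \<epsilon> p q n c X S" "x < p" "y < q"
  shows "\<bar>S $$ (x, y) - (\<Sum>i<n. c i * X i $$ (x, y))\<bar>
    \<le> ((1 + \<epsilon>) ^ (\<Sum>i<n. of_bool (c i \<noteq> 0)) - 1) * (\<Sum>i<n. \<bar>c i\<bar> * \<bar>X i $$ (x, y)\<bar>)"
proof -
  let ?l = "[(c i, X i $$ (x, y)). i \<leftarrow> [0..<n], c i \<noteq> 0]"
  have "fl_sum_of_products \<epsilon> ?l (S $$ (x, y))"
    using assms unfolding fl_lin_comb_def by blast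
  from fl_sum_of_products_error[OF assms(1) this] show ?thesis
    unfolding length_filtered_upt by (subst (asm) (1 2) sum_list_filtered_upt) auto
qed

lemma sum_abs_mult_le:
  fixes c f :: "nat \<Rightarrow> real"
  assumes "\<And>i. i < n \<Longrightarrow> \<bar>f i\<bar> \<le> z"
  shows "(\<Sum>i<n. \<bar>c i\<bar> * \<bar>f i\<bar>) \<le> (\<Sum>i<n. \<bar>c i\<bar>) * z"
  unfolding sum_distrib_right using assms by (intro sum_mono mult_left_mono) auto

lemma abs_sum_mult_le:
  fixes c f :: "nat \<Rightarrow> real"
  assumes "\<And>i. i < n \<Longrightarrow> \<bar>f i\<bar> \<le> z"
  shows "\<bar>\<Sum>i<n. c i * f i\<bar> \<le> (\<Sum>i<n. \<bar>c i\<bar>) * z"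
proof -
  have "\<bar>\<Sum>i<n. c i * f i\<bar> \<le> (\<Sum>i<n. \<bar>c i * f i\<bar>)" by (rule sum_abs)
  also have "\<dots> \<le> (\<Sum>i<n. \<bar>c i\<bar>) * z"
    unfolding abs_mult using assms by (rule sum_abs_mult_le)
  finally show ?thesis .
qed

text \<open>For the combinations given by \<open>U\<close> and \<open>V\<close>, whose blocks share
  one entry bound. The combination given by \<open>W\<close> uses the unweakened version, since the
  products \<open>P r\<close> have bounds depending on \<open>r\<close>.\<close>

lemma fl_lin_comb_error_uniform:
  assumes "0 < \<epsilon>" "fl_lin_comb \<epsilon> p q n c X S" "x < p" "y < q"
    and "\<And>i. i < n \<Longrightarrow> \<bar>X i $$ (x, y)\<bar> \<le> z"
  shows "\<bar>S $$ (x, y) - (\<Sum>i<n. c i * X i $$ (x, y))\<bar>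
    \<le> ((1 + \<epsilon>) ^ (\<Sum>i<n. of_bool (c i \<noteq> 0)) - 1) * ((\<Sum>i<n. \<bar>c i\<bar>) * z)"
proof -
  have "((1 + \<epsilon>) ^ (\<Sum>i<n. of_bool (c i \<noteq> 0)) - 1) * (\<Sum>i<n. \<bar>c i\<bar> * \<bar>X i $$ (x, y)\<bar>)
    \<le> ((1 + \<epsilon>) ^ (\<Sum>i<n. of_bool (c i \<noteq> 0)) - 1) * ((\<Sum>i<n. \<bar>c i\<bar>) * z)"
    using assms(1,5) by (intro mult_left_mono sum_abs_mult_le) auto
  with fl_lin_comb_error[OF assms(1-4)] show ?thesis by linarith
qed

section \<open>Matrix products: rounding and perturbed factors\<close>

text \<open>The two occurrences of \<open>n\<close> have different origins: the factor is the number
  of summands, each at most \<open>a * b\<close> in absolute value, and the exponent is the number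
  of roundings.\<close>

lemma fl_classical_product_error:
  assumes "0 < \<epsilon>" "fl_classical_product \<epsilon> A B C"
    and A: "A \<in> carrier_mat m n" and B: "B \<in> carrier_mat n s"
    and bA: "\<And>x y. x < m \<Longrightarrow> y < n \<Longrightarrow> \<bar>A $$ (x, y)\<bar> \<le> a"
    and bB: "\<And>x y. x < n \<Longrightarrow> y < s \<Longrightarrow> \<bar>B $$ (x, y)\<bar> \<le> b"
    and x: "x < m" and y: "y < s"
  shows "\<bar>C $$ (x, y) - (A * B) $$ (x, y)\<bar> \<le> real n * ((1 + \<epsilon>) ^ n - 1) * (a * b)"
proof -
  let ?l = "[(A $$ (x, l), B $$ (l, y)). l \<leftarrow> [0..<n]]"
  have "fl_sum_of_products \<epsilon> ?l (C $$ (x, y))"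
    using assms unfolding fl_classical_product_def by auto
  note e = fl_sum_of_products_error[OF assms(1) this]
  have AB: "(A * B) $$ (x, y) = sum_list (map (\<lambda>(c, x). c * x) ?l)"
    using A B x y
    by (auto simp: scalar_prod_def o_def interv_sum_list_conv_sum_set_nat intro!: sum.cong)
  have "sum_list (map (\<lambda>(c, x). \<bar>c\<bar> * \<bar>x\<bar>) ?l) = (\<Sum>l<n. \<bar>A $$ (x, l)\<bar> * \<bar>B $$ (l, y)\<bar>)"
    by (simp add: o_def interv_sum_list_conv_sum_set_nat atLeast0LessThan)
  also have "\<dots> \<le> (\<Sum>l<n. a * b)"
  proof (rule sum_mono)
    fix l assume "l \<in> {..<n}"
    then have "\<bar>A $$ (x, l)\<bar> \<le> a" "\<bar>B $$ (l, y)\<bar> \<le> b" using bA bB x y by auto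
    then show "\<bar>A $$ (x, l)\<bar> * \<bar>B $$ (l, y)\<bar> \<le> a * b" by (intro mult_mono) auto
  qed
  finally have t: "sum_list (map (\<lambda>(c, x). \<bar>c\<bar> * \<bar>x\<bar>) ?l) \<le> real n * (a * b)" by simp
  have "((1 + \<epsilon>) ^ n - 1) * sum_list (map (\<lambda>(c, x). \<bar>c\<bar> * \<bar>x\<bar>) ?l)
      \<le> ((1 + \<epsilon>) ^ n - 1) * (real n * (a * b))"
    using assms(1) by (intro mult_left_mono[OF t]) auto
  with e show ?thesis unfolding AB by (simp add: mult_ac)
qed

text \<open>Propagation of errors in the factors through an exact product: growth factors
  \<open>f\<close> and \<open>g\<close> multiply. Only row \<open>x\<close> of the left and column
  \<open>y\<close> of the right factor matter.\<close>

lemma mult_mat_perturbation: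
  fixes S T S' T' :: "real mat"
  assumes "S \<in> carrier_mat p q" "T \<in> carrier_mat q s" "S' \<in> carrier_mat p q" "T' \<in> carrier_mat q s"
    and S: "\<And>y. y < q \<Longrightarrow> \<bar>S $$ (x, y)\<bar> \<le> a" and T: "\<And>x. x < q \<Longrightarrow> \<bar>T $$ (x, y)\<bar> \<le> b"
    and S': "\<And>y. y < q \<Longrightarrow> \<bar>S' $$ (x, y) - S $$ (x, y)\<bar> \<le> (f - 1) * a"
    and T': "\<And>x. x < q \<Longrightarrow> \<bar>T' $$ (x, y) - T $$ (x, y)\<bar> \<le> (g - 1) * b"
    and fg: "1 \<le> f" "1 \<le> g" and ab: "0 \<le> a" "0 \<le> b" and x: "x < p" and y: "y < s"
  shows "\<bar>(S' * T') $$ (x, y) - (S * T) $$ (x, y)\<bar> \<le> real q * ((f * g - 1) * (a * b))"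
    and "\<bar>(S * T) $$ (x, y)\<bar> \<le> real q * (a * b)"
proof -
  have e: "(S' * T') $$ (x, y) - (S * T) $$ (x, y)
      = (\<Sum>l<q. S' $$ (x, l) * T' $$ (l, y) - S $$ (x, l) * T $$ (l, y))"
    "(S * T) $$ (x, y) = (\<Sum>l<q. S $$ (x, l) * T $$ (l, y))"
    using assms by (simp_all add: scalar_prod_def sum_subtractf atLeast0LessThan)
  have "\<bar>S' $$ (x, l) * T' $$ (l, y) - S $$ (x, l) * T $$ (l, y)\<bar> \<le> (f * g - 1) * (a * b)"
    if l: "l < q" for l
  proof -
    let ?ds = "S' $$ (x, l) - S $$ (x, l)" and ?dt = "T' $$ (l, y) - T $$ (l, y)"
    have "\<bar>T' $$ (l, y)\<bar> \<le> g * b" using T[OF l] T'[OF l] by (simp add: algebra_simps)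
    then have "\<bar>?ds * T' $$ (l, y)\<bar> \<le> ((f - 1) * a) * (g * b)"
      unfolding abs_mult using S'[OF l] fg ab by (intro mult_mono) auto
    moreover have "\<bar>S $$ (x, l) * ?dt\<bar> \<le> a * ((g - 1) * b)"
      unfolding abs_mult using S[OF l] T'[OF l] ab by (intro mult_mono) auto
    \<comment> \<open>The two parts add up because (f - 1) * g + (g - 1) = f * g - 1.\<close>
    moreover have "S' $$ (x, l) * T' $$ (l, y) - S $$ (x, l) * T $$ (l, y)
        = ?ds * T' $$ (l, y) + S $$ (x, l) * ?dt"
      by (simp add: algebra_simps)
    ultimately show ?thesis by (simp add: algebra_simps)
  qed
  then have "\<bar>(S' * T') $$ (x, y) - (S * T) $$ (x, y)\<bar> \<le> (\<Sum>l<q. (f * g - 1) * (a * b))"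
    unfolding e(1) by (intro order_trans[OF sum_abs] sum_mono) auto
  then show "\<bar>(S' * T') $$ (x, y) - (S * T) $$ (x, y)\<bar> \<le> real q * ((f * g - 1) * (a * b))" by simp
  have "\<bar>S $$ (x, l) * T $$ (l, y)\<bar> \<le> a * b" if l: "l < q" for l
    unfolding abs_mult using S[OF l] T[OF l] ab by (intro mult_mono) auto
  then have "\<bar>(S * T) $$ (x, y)\<bar> \<le> (\<Sum>l<q. a * b)"
    unfolding e(2) by (intro order_trans[OF sum_abs] sum_mono) auto
  then show "\<bar>(S * T) $$ (x, y)\<bar> \<le> real q * (a * b)" by simp
qed

section \<open>Blocks\<close>

lemma block_index_less:
  fixes I x m p :: nat
  assumes "I < m" "x < p"
  shows "I * p + x < m * p"
proof -
  have "I * p + x < Suc I * p" using assms by simp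
  also have "\<dots> \<le> m * p" using assms by (intro mult_le_mono1) auto
  finally show ?thesis .
qed

lemma block_col_major_bound:
  assumes "\<And>x y. x < m * p \<Longrightarrow> y < n * q \<Longrightarrow> \<bar>X $$ (x, y)\<bar> \<le> a"
    and "i < m * n" "x < p" "y < q"
  shows "\<bar>block_col_major m p q X i $$ (x, y)\<bar> \<le> a"
proof -
  have "0 < m" using assms(2) by (cases m) auto
  then have "i mod m < m" "i div m < n"
    using assms(2) by (auto simp: less_mult_imp_div_less mult.commute)
  then show ?thesis
    using assms by (simp add: block_col_major_def block_def block_index_less)
qed

text \<open>Inverts the block addressing, so that an entrywise claim about a product can be read off
  from the blockwise formulas.\<close>

lemma index_block_row_major:
  assumes "x < m * p" "y < n * s"
  defines "k \<equiv> x div p * n + y div s"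
  shows "k < m * n" "x mod p < p" "y mod s < s"
    and "block_row_major n p s X k $$ (x mod p, y mod s) = X $$ (x, y)"
proof -
  have pos: "0 < p" "0 < s" "0 < n" using assms by (auto intro!: gr0I)
  then show m: "x mod p < p" "y mod s < s" by auto
  have d: "x div p < m" "y div s < n" using assms by (auto simp: less_mult_imp_div_less)
  then show "k < m * n" unfolding k_def by (rule block_index_less)
  have "k div n = x div p" "k mod n = y div s" using d pos by (auto simp: k_def)
  then show "block_row_major n p s X k $$ (x mod p, y mod s) = X $$ (x, y)"
    using m by (simp add: block_row_major_def block_def)
qed

section \<open>Bilinear algorithms\<close>

lemma bilinear_algorithmD:
  assumes "bilinear_algorithm M0 K0 N0 R U V W"
  shows "0 < M0" "0 < K0" "0 < N0"
    and "U \<in> carrier_mat (M0 * K0) R" "V \<in> carrier_mat (K0 * N0) R" "W \<in> carrier_mat (M0 * N0) R"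
  using assms unfolding bilinear_algorithm_def by auto

lemma bilinear_algorithm_block:
  assumes "bilinear_algorithm M0 K0 N0 R U V W"
    and "A \<in> carrier_mat (M0 * p) (K0 * q)" "B \<in> carrier_mat (K0 * q) (N0 * s)" "k < M0 * N0"
  shows "block_row_major N0 p s (A * B) k = lin_comb p s R (\<lambda>r. W $$ (k, r))
    (\<lambda>r. lin_comb p q (M0 * K0) (\<lambda>i. U $$ (i, r)) (block_col_major M0 p q A) *
         lin_comb q s (K0 * N0) (\<lambda>j. V $$ (j, r)) (block_col_major K0 q s B))"
  using assms unfolding bilinear_algorithm_def Let_def by blast

lemma stability_factor_ge:
  assumes "W \<in> carrier_mat m R" "k < m"
  shows "(\<Sum>r<R. \<bar>W $$ (k, r)\<bar> * (col_abs_sum U r * col_abs_sum V r)) \<le> stability_factor U V W"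
proof -
  have "(\<Sum>r<dim_col W. col_abs_sum U r * col_abs_sum V r * \<bar>W $$ (k, r)\<bar>) \<le> stability_factor U V W"
    unfolding stability_factor_def using assms by (intro Max_ge) auto
  then show ?thesis using assms by (simp add: mult_ac)
qed

text \<open>For a nonzero coefficient the indicator is 1, so \<open>r\<close> takes part in the
  inner maximum. In the recursion a zero coefficient removes the whole term.\<close>

lemma prefactor_ge:
  assumes "W \<in> carrier_mat m R" "k < m" "r < R" "W $$ (k, r) \<noteq> 0"
  shows "row_nonzeros W k + (col_nonzeros U r + col_nonzeros V r) \<le> prefactor U V W"
proof -
  let ?h = "\<lambda>r. (col_nonzeros U r + col_nonzeros V r) * of_bool (W $$ (k, r) \<noteq> 0)"
  have "?h r \<le> (MAX r \<in> {..<dim_col W}. ?h r)" using assms by (intro Max_ge) auto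
  moreover have "row_nonzeros W k + (MAX r \<in> {..<dim_col W}. ?h r) \<le> prefactor U V W"
    unfolding prefactor_def using assms by (intro Max_ge) auto
  ultimately show ?thesis using assms by simp
qed

lemma col_abs_sum_nonneg: "0 \<le> col_abs_sum X r"
  unfolding col_abs_sum_def by (rule sum_nonneg) auto

text \<open>With all-ones matrices and blocks of size 1, each product entry is \<open>K0\<close>,
  while the linear forms are at most \<open>col_abs_sum U r\<close> and
  \<open>col_abs_sum V r\<close> in absolute value. The formula for entry 0 then bounds
  \<open>K0\<close> by the corresponding row sum in \<open>E\<close>.\<close>

lemma inner_dim_le_stability_factor:
  assumes alg: "bilinear_algorithm M0 K0 N0 R U V W"
  shows "real K0 \<le> stability_factor U V W"
proof -
  note D = bilinear_algorithmD[OF alg]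
  define A B where "A = mat M0 K0 (\<lambda>_. 1::real)" and "B = mat K0 N0 (\<lambda>_. 1::real)"
  let ?S = "\<lambda>r. lin_comb 1 1 (M0 * K0) (\<lambda>i. U $$ (i, r)) (block_col_major M0 1 1 A)"
  let ?T = "\<lambda>r. lin_comb 1 1 (K0 * N0) (\<lambda>j. V $$ (j, r)) (block_col_major K0 1 1 B)"
  have "(A * B) $$ (0, 0) = block_row_major N0 1 1 (A * B) 0 $$ (0, 0)"
    using index_block_row_major(4)[of 0 M0 1 0 N0 1 "A * B"] D by simp
  also have "\<dots> = (\<Sum>r<R. W $$ (0, r) * (?S r * ?T r) $$ (0, 0))"
    using bilinear_algorithm_block[OF alg, of A 1 1 B 1 0] D
    by (simp add: A_def B_def lin_comb_def)
  also have "(A * B) $$ (0, 0) = real K0"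
    using D by (simp add: A_def B_def scalar_prod_def)
  finally have "real K0 = \<bar>\<Sum>r<R. W $$ (0, r) * (?S r * ?T r) $$ (0, 0)\<bar>" by simp
  also have "\<dots> \<le> (\<Sum>r<R. \<bar>W $$ (0, r)\<bar> * (col_abs_sum U r * col_abs_sum V r))"
  proof (rule order_trans[OF sum_abs], rule sum_mono)
    fix r
    have S: "\<bar>?S r $$ (0, 0)\<bar> \<le> col_abs_sum U r"
    proof -
      have "\<bar>block_col_major M0 1 1 A i $$ (0, 0)\<bar> \<le> 1" if "i < M0 * K0" for i
        using that by (intro block_col_major_bound[where n = K0]) (auto simp: A_def)
      from abs_sum_mult_le[of "M0 * K0" _ 1 "\<lambda>i. U $$ (i, r)", OF this]
      show ?thesis using D(4) by (simp add: lin_comb_def col_abs_sum_def)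
    qed
    have T: "\<bar>?T r $$ (0, 0)\<bar> \<le> col_abs_sum V r"
    proof -
      have "\<bar>block_col_major K0 1 1 B i $$ (0, 0)\<bar> \<le> 1" if "i < K0 * N0" for i
        using that by (intro block_col_major_bound[where n = N0]) (auto simp: B_def)
      from abs_sum_mult_le[of "K0 * N0" _ 1 "\<lambda>i. V $$ (i, r)", OF this]
      show ?thesis using D(5) by (simp add: lin_comb_def col_abs_sum_def)
    qed
    have "(?S r * ?T r) $$ (0, 0) = ?S r $$ (0, 0) * ?T r $$ (0, 0)"
      by (simp add: lin_comb_def scalar_prod_def)
    then show "\<bar>W $$ (0, r) * (?S r * ?T r) $$ (0, 0)\<bar>
        \<le> \<bar>W $$ (0, r)\<bar> * (col_abs_sum U r * col_abs_sum V r)"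
      unfolding abs_mult using S T
      by (auto simp: abs_mult intro!: mult_left_mono mult_mono col_abs_sum_nonneg)
  qed
  also have "\<dots> \<le> stability_factor U V W"
    using D by (intro stability_factor_ge[OF D(6)]) simp
  finally show ?thesis .
qed

section \<open>The recursion\<close>

text \<open>Each level multiplies the amplification by \<open>E\<close> and adds at most
  \<open>Q\<close> roundings to the exponent. Entry bounds \<open>a\<close>, \<open>b\<close>
  replace norms because the hypothesis is applied to computed operands, for which only bounds are
  known.\<close>

lemma fl_recursive_product_error:
  assumes alg: "bilinear_algorithm M0 K0 N0 R U V W" and eps: "0 < \<epsilon>"
    and "fl_recursive_product M0 K0 N0 R U V W \<epsilon> L A B C"
    and "A \<in> carrier_mat (M0 ^ L * m) (K0 ^ L * n)" "B \<in> carrier_mat (K0 ^ L * n) (N0 ^ L * s)"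
    and "\<And>x y. x < M0 ^ L * m \<Longrightarrow> y < K0 ^ L * n \<Longrightarrow> \<bar>A $$ (x, y)\<bar> \<le> a"
    and "\<And>x y. x < K0 ^ L * n \<Longrightarrow> y < N0 ^ L * s \<Longrightarrow> \<bar>B $$ (x, y)\<bar> \<le> b"
    and "0 \<le> a" "0 \<le> b"
    and "x < M0 ^ L * m" "y < N0 ^ L * s"
  shows "\<bar>C $$ (x, y) - (A * B) $$ (x, y)\<bar> \<le> real n * stability_factor U V W ^ L *
    ((1 + \<epsilon>) ^ (prefactor U V W * L + n) - 1) * (a * b)"
  using assms(3-)
proof (induction L arbitrary: A B C a b x y)
  case 0
  show ?case
    using fl_classical_product_error[OF eps, of A B C m n s a b x y] 0 by simp
next
  case (Suc L)
  note D = bilinear_algorithmD[OF alg]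
  define E Q u where "E = stability_factor U V W" and "Q = prefactor U V W" and "u = 1 + \<epsilon>"
  define p q t where "p = M0 ^ L * m" and "q = K0 ^ L * n" and "t = N0 ^ L * s"
  have dims: "M0 ^ Suc L * m = M0 * p" "K0 ^ Suc L * n = K0 * q" "N0 ^ Suc L * s = N0 * t"
    by (simp_all add: p_def q_def t_def)
  note prems = Suc.prems[unfolded dims]
  note A = prems(2) and B = prems(3) and bA = prems(4) and bB = prems(5)
    and ab = prems(6,7) and x = prems(8) and y = prems(9)
  have u: "1 \<le> u" and pow: "1 \<le> u ^ j" for j using eps by (simp_all add: u_def)
  have E: "real K0 \<le> E" unfolding E_def by (rule inner_dim_le_stability_factor[OF alg])
  define F where "F = real n * E ^ L"
  have F: "0 \<le> F" using E by (simp add: F_def)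
  \<comment> \<open>The exact inner dimension \<open>q\<close> appears when errors in the operands
    propagate. Bounding it by \<open>F\<close> lets them merge with the errors of the recursive
    product.\<close>
  have qF: "real q \<le> F"
    using power_mono[OF E, of L] by (simp add: q_def F_def mult.commute mult_left_mono)
  have "dim_row A div M0 = p" "dim_col A div K0 = q" "dim_col B div N0 = t"
    using A B D by simp_all
  with prems(1) obtain S' T' P where
    S': "\<And>r. r < R \<Longrightarrow> fl_lin_comb \<epsilon> p q (M0 * K0) (\<lambda>i. U $$ (i, r)) (block_col_major M0 p q A) (S' r)"
    and T': "\<And>r. r < R \<Longrightarrow> fl_lin_comb \<epsilon> q t (K0 * N0) (\<lambda>j. V $$ (j, r)) (block_col_major K0 q t B) (T' r)"
    and P: "\<And>r. r < R \<Longrightarrow> fl_recursive_product M0 K0 N0 R U V W \<epsilon> L (S' r) (T' r) (P r)"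
    and C: "\<And>k. k < M0 * N0 \<Longrightarrow>
      fl_lin_comb \<epsilon> p t R (\<lambda>r. W $$ (k, r)) P (block_row_major N0 p t C k)"
    by (auto simp: Let_def)
  \<comment> \<open>\<open>S\<close>, \<open>T\<close> are the exact operands; the primed versions
    are the computed ones.\<close>
  define S where "S r = lin_comb p q (M0 * K0) (\<lambda>i. U $$ (i, r)) (block_col_major M0 p q A)" for r
  define T where "T r = lin_comb q t (K0 * N0) (\<lambda>j. V $$ (j, r)) (block_col_major K0 q t B)" for r
  \<comment> \<open>The fixed entry of \<open>C\<close> lies in block \<open>k\<close> at position
    (\<open>x'\<close>, \<open>y'\<close>).\<close>
  define k where "k = x div p * N0 + y div t"
  define x' y' where "x' = x mod p" and "y' = y mod t"
  note idx = index_block_row_major[OF x y, folded k_def x'_def y'_def]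
  define \<alpha> \<beta> where "\<alpha> = col_nonzeros U" and "\<beta> = col_nonzeros V"
  define a' b' where "a' r = col_abs_sum U r * a" and "b' r = col_abs_sum V r * b" for r
  have nn: "0 \<le> a' r" "0 \<le> b' r" for r
    using ab by (auto simp: a'_def b'_def intro!: mult_nonneg_nonneg col_abs_sum_nonneg)
  have carr: "S r \<in> carrier_mat p q" "T r \<in> carrier_mat q t" for r
    by (simp_all add: S_def T_def lin_comb_def)
  have carr': "S' r \<in> carrier_mat p q" "T' r \<in> carrier_mat q t" if "r < R" for r
    using S'[OF that] T'[OF that] by (auto simp: fl_lin_comb_def)
  have Sb: "\<bar>S r $$ (i, j)\<bar> \<le> a' r" if "i < p" "j < q" for r i j
  proof -
    have "\<bar>block_col_major M0 p q A l $$ (i, j)\<bar> \<le> a" if "l < M0 * K0" for l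
      using bA that \<open>i < p\<close> \<open>j < q\<close> by (rule block_col_major_bound)
    from abs_sum_mult_le[of "M0 * K0" _ a "\<lambda>i. U $$ (i, r)", OF this]
    show ?thesis using that D by (simp add: S_def lin_comb_def a'_def col_abs_sum_def)
  qed
  have Tb: "\<bar>T r $$ (i, j)\<bar> \<le> b' r" if "i < q" "j < t" for r i j
  proof -
    have "\<bar>block_col_major K0 q t B l $$ (i, j)\<bar> \<le> b" if "l < K0 * N0" for l
      using bB that \<open>i < q\<close> \<open>j < t\<close> by (rule block_col_major_bound)
    from abs_sum_mult_le[of "K0 * N0" _ b "\<lambda>i. V $$ (i, r)", OF this]
    show ?thesis using that D by (simp add: T_def lin_comb_def b'_def col_abs_sum_def)
  qed
  have Sd: "\<bar>S' r $$ (i, j) - S r $$ (i, j)\<bar> \<le> (u ^ \<alpha> r - 1) * a' r"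
    if "r < R" "i < p" "j < q" for r i j
  proof -
    have "\<bar>block_col_major M0 p q A l $$ (i, j)\<bar> \<le> a" if "l < M0 * K0" for l
      using bA that \<open>i < p\<close> \<open>j < q\<close> by (rule block_col_major_bound)
    from fl_lin_comb_error_uniform[OF eps S'[OF that(1)] that(2,3) this]
    show ?thesis using that D
      by (simp add: S_def lin_comb_def a'_def col_abs_sum_def u_def \<alpha>_def col_nonzeros_def)
  qed
  have Td: "\<bar>T' r $$ (i, j) - T r $$ (i, j)\<bar> \<le> (u ^ \<beta> r - 1) * b' r"
    if "r < R" "i < q" "j < t" for r i j
  proof -
    have "\<bar>block_col_major K0 q t B l $$ (i, j)\<bar> \<le> b" if "l < K0 * N0" for l
      using bB that \<open>i < q\<close> \<open>j < t\<close> by (rule block_col_major_bound)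
    from fl_lin_comb_error_uniform[OF eps T'[OF that(1)] that(2,3) this]
    show ?thesis using that D
      by (simp add: T_def lin_comb_def b'_def col_abs_sum_def u_def \<beta>_def col_nonzeros_def)
  qed
  \<comment> \<open>Total growth factor of \<open>P r\<close>: the recursive multiplication times
    the formation of its two operands.\<close>
  define d where "d r = u ^ (Q * L + n) * (u ^ \<alpha> r * u ^ \<beta> r)" for r
  have d: "1 \<le> d r" for r
    unfolding d_def by (metis pow power_add)
  define X where "X r = (S r * T r) $$ (x', y')" for r
  have X: "\<bar>X r\<bar> \<le> F * (a' r * b' r)"
    and PX: "\<bar>P r $$ (x', y') - X r\<bar> \<le> F * ((d r - 1) * (a' r * b' r))" if r: "r < R" for r
  proof -
    have S'b: "\<bar>S' r $$ (i, j)\<bar> \<le> u ^ \<alpha> r * a' r" if "i < p" "j < q" for i j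
      using Sb[OF that, of r] Sd[OF r that] by (simp add: algebra_simps)
    have T'b: "\<bar>T' r $$ (i, j)\<bar> \<le> u ^ \<beta> r * b' r" if "i < q" "j < t" for i j
      using Tb[OF that, of r] Td[OF r that] by (simp add: algebra_simps)
    have "0 \<le> u ^ \<alpha> r * a' r" "0 \<le> u ^ \<beta> r * b' r" using u nn[of r] by simp_all
    \<comment> \<open>The induction hypothesis compares \<open>P r\<close> with the exact product of
      the computed operands, whose entry bounds carry the extra factors
      \<open>u ^ \<alpha> r\<close> and \<open>u ^ \<beta> r\<close>.\<close>
    from Suc.IH[folded p_def q_def t_def, OF P[OF r] carr'[OF r] S'b T'b this idx(2,3)]
    have 1: "\<bar>P r $$ (x', y') - (S' r * T' r) $$ (x', y')\<bar>
        \<le> F * ((u ^ (Q * L + n) - 1) * (u ^ \<alpha> r * u ^ \<beta> r) * (a' r * b' r))"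
      by (simp add: E_def Q_def u_def F_def mult_ac)
    \<comment> \<open>The remaining gap, from the product of computed operands to that of exact
      ones.\<close>
    note pert = mult_mat_perturbation[OF carr carr'[OF r], OF Sb[OF idx(2)] Tb[OF _ idx(3)]
        Sd[OF r idx(2)] Td[OF r _ idx(3)] pow pow nn idx(2,3), folded X_def]
    have "real q * (a' r * b' r) \<le> F * (a' r * b' r)"
      using qF nn[of r] by (intro mult_right_mono) auto
    with pert(2) show "\<bar>X r\<bar> \<le> F * (a' r * b' r)" by linarith
    have "real q * ((u ^ \<alpha> r * u ^ \<beta> r - 1) * (a' r * b' r))
        \<le> F * ((u ^ \<alpha> r * u ^ \<beta> r - 1) * (a' r * b' r))"
      using qF nn[of r] pow[of "\<alpha> r + \<beta> r"] by (intro mult_right_mono) (auto simp: power_add)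
    with pert(1) have "\<bar>(S' r * T' r) $$ (x', y') - X r\<bar>
        \<le> F * ((u ^ \<alpha> r * u ^ \<beta> r - 1) * (a' r * b' r))" by linarith
    with 1 have "\<bar>P r $$ (x', y') - X r\<bar> \<le> F * ((u ^ (Q * L + n) - 1) * (u ^ \<alpha> r * u ^ \<beta> r) * (a' r * b' r))
        + F * ((u ^ \<alpha> r * u ^ \<beta> r - 1) * (a' r * b' r))" by linarith
    then show "\<bar>P r $$ (x', y') - X r\<bar> \<le> F * ((d r - 1) * (a' r * b' r))"
      by (simp add: d_def algebra_simps)
  qed
  define w where "w r = W $$ (k, r)" for r
  define \<gamma> where "\<gamma> = row_nonzeros W k"
  have AB: "(A * B) $$ (x, y) = (\<Sum>r<R. w r * X r)"
    using bilinear_algorithm_block[OF alg A B idx(1)] idx(2,3)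
    by (simp add: idx(4)[of "A * B", symmetric] lin_comb_def S_def T_def X_def w_def)
  \<comment> \<open>First part of the error: rounding in the combination given by \<open>W\<close>.
    The second part, below, is the error already present in the \<open>P r\<close>.\<close>
  have "\<bar>C $$ (x, y) - (\<Sum>r<R. w r * P r $$ (x', y'))\<bar>
      \<le> (u ^ \<gamma> - 1) * (\<Sum>r<R. \<bar>w r\<bar> * \<bar>P r $$ (x', y')\<bar>)"
    using fl_lin_comb_error[OF eps C[OF idx(1)] idx(2,3)] D(6)
    by (simp add: idx(4) w_def \<gamma>_def row_nonzeros_def u_def)
  also have "\<dots> = (\<Sum>r<R. \<bar>w r\<bar> * ((u ^ \<gamma> - 1) * \<bar>P r $$ (x', y')\<bar>))"
    by (simp add: sum_distrib_left mult_ac)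
  finally have 1: "\<bar>C $$ (x, y) - (\<Sum>r<R. w r * P r $$ (x', y'))\<bar> \<le> \<dots>" .
  have "\<bar>(\<Sum>r<R. w r * P r $$ (x', y')) - (A * B) $$ (x, y)\<bar>
      = \<bar>\<Sum>r<R. w r * (P r $$ (x', y') - X r)\<bar>"
    by (simp add: AB sum_subtractf algebra_simps)
  also have "\<dots> \<le> (\<Sum>r<R. \<bar>w r\<bar> * \<bar>P r $$ (x', y') - X r\<bar>)"
    by (rule order_trans[OF sum_abs]) (simp add: abs_mult)
  finally have "\<bar>C $$ (x, y) - (A * B) $$ (x, y)\<bar> \<le>
      (\<Sum>r<R. \<bar>w r\<bar> * ((u ^ \<gamma> - 1) * \<bar>P r $$ (x', y')\<bar> + \<bar>P r $$ (x', y') - X r\<bar>))"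
    using 1 by (simp add: sum.distrib distrib_left)
  also have "\<dots> \<le> (\<Sum>r<R. F * (u ^ (Q * Suc L + n) - 1) * (a * b) *
      (\<bar>w r\<bar> * (col_abs_sum U r * col_abs_sum V r)))"
  proof (rule sum_mono)
    fix r assume "r \<in> {..<R}"
    then have r: "r < R" by simp
    show "\<bar>w r\<bar> * ((u ^ \<gamma> - 1) * \<bar>P r $$ (x', y')\<bar> + \<bar>P r $$ (x', y') - X r\<bar>)
      \<le> F * (u ^ (Q * Suc L + n) - 1) * (a * b) * (\<bar>w r\<bar> * (col_abs_sum U r * col_abs_sum V r))"
    \<comment> \<open>If \<open>w r = 0\<close>, both sides vanish. Otherwise the roundings of this
      level number at most \<gamma> + \<alpha> + \<beta>, which \<open>Q\<close> bounds.\<close>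
    proof (cases "w r = 0")
      case False
      have "\<gamma> + (\<alpha> r + \<beta> r) \<le> Q"
        using prefactor_ge[OF D(6) idx(1) r] False by (simp add: w_def \<gamma>_def \<alpha>_def \<beta>_def Q_def)
      then have "u ^ (\<gamma> + (\<alpha> r + \<beta> r) + (Q * L + n)) \<le> u ^ (Q * Suc L + n)"
        using u by (intro power_increasing) auto
      then have ud: "u ^ \<gamma> * d r \<le> u ^ (Q * Suc L + n)"
        by (simp add: d_def power_add mult_ac)
      have "\<bar>P r $$ (x', y')\<bar> \<le> F * (d r * (a' r * b' r))"
        using X[OF r] PX[OF r] by (simp add: algebra_simps)
      then have "(u ^ \<gamma> - 1) * \<bar>P r $$ (x', y')\<bar> \<le> (u ^ \<gamma> - 1) * (F * (d r * (a' r * b' r)))"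
        using pow[of \<gamma>] by (intro mult_left_mono) auto
      with PX[OF r] have "(u ^ \<gamma> - 1) * \<bar>P r $$ (x', y')\<bar> + \<bar>P r $$ (x', y') - X r\<bar>
          \<le> (u ^ \<gamma> - 1) * (F * (d r * (a' r * b' r))) + F * ((d r - 1) * (a' r * b' r))"
        by linarith
      \<comment> \<open>Growth factors compose once more: (u^\<gamma> - 1) * d + (d - 1) =
        u^\<gamma> * d - 1.\<close>
      also have "\<dots> = F * (a' r * b' r) * (u ^ \<gamma> * d r - 1)" by (simp add: algebra_simps)
      also have "\<dots> \<le> F * (a' r * b' r) * (u ^ (Q * Suc L + n) - 1)"
        using ud F nn[of r] by (intro mult_left_mono) auto
      finally have "\<bar>w r\<bar> * ((u ^ \<gamma> - 1) * \<bar>P r $$ (x', y')\<bar> + \<bar>P r $$ (x', y') - X r\<bar>)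
          \<le> \<bar>w r\<bar> * (F * (a' r * b' r) * (u ^ (Q * Suc L + n) - 1))"
        by (intro mult_left_mono) auto
      then show ?thesis by (simp add: a'_def b'_def mult_ac)
    qed simp
  qed
  also have "\<dots> = F * (u ^ (Q * Suc L + n) - 1) * (a * b) *
      (\<Sum>r<R. \<bar>w r\<bar> * (col_abs_sum U r * col_abs_sum V r))"
    by (simp only: sum_distrib_left)
  \<comment> \<open>The sum over \<open>r\<close> is the quantity e_k of the stability factor; it
    supplies the new power of \<open>E\<close>.\<close>
  also have "\<dots> \<le> F * (u ^ (Q * Suc L + n) - 1) * (a * b) * E"
    unfolding w_def E_def using F ab pow[of "Q * Suc L + n"]
    by (intro mult_left_mono stability_factor_ge[OF D(6) idx(1)] mult_nonneg_nonneg) auto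
  also have "\<dots> = real n * E ^ Suc L * (u ^ (Q * Suc L + n) - 1) * (a * b)"
    by (simp add: F_def mult_ac)
  finally show ?case unfolding E_def Q_def u_def .
qed

section \<open>The max-norm\<close>

lemma elements_mat_eq_image:
  "elements_mat X = (\<lambda>(i, j). X $$ (i, j)) ` ({..<dim_row X} \<times> {..<dim_col X})"
  unfolding elements_mat_def by auto

lemma max_norm_ge:
  assumes "x < dim_row X" "y < dim_col X"
  shows "\<bar>X $$ (x, y)\<bar> \<le> max_norm X"
  unfolding max_norm_def elements_mat_eq_image using assms by (intro Max_ge) auto

text \<open>Positive dimensions make the set of entries nonempty, as the characterization of upper
  bounds of \<open>Max\<close> requires.\<close>

lemma max_norm_le:
  assumes "0 < dim_row X" "0 < dim_col X"
    and "\<And>x y. x < dim_row X \<Longrightarrow> y < dim_col X \<Longrightarrow> \<bar>X $$ (x, y)\<bar> \<le> z"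
  shows "max_norm X \<le> z"
  unfolding max_norm_def elements_mat_eq_image using assms by (subst Max_le_iff) auto

section \<open>Quadratic remainder and conclusion\<close>

text \<open>Writing r_j for the remainder, r_(j+1) = (1 + \<epsilon>) * r_j + j * \<epsilon>^2, and
  1 + \<epsilon> is bounded near 0.\<close>

lemma power_minus_linear_bigo:
  "(\<lambda>\<epsilon>::real. (1 + \<epsilon>) ^ j - 1 - real j * \<epsilon>) \<in> O[at_right 0](\<lambda>\<epsilon>. \<epsilon>\<^sup>2)"
proof (induction j)
  case (Suc j)
  have "(\<lambda>\<epsilon>::real. (1 + \<epsilon>) * ((1 + \<epsilon>) ^ j - 1 - real j * \<epsilon>)) \<in> O[at_right 0](\<lambda>\<epsilon>. 1 * \<epsilon>\<^sup>2)"
    by (rule landau_o.big.mult[OF _ Suc]) real_asymp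
  moreover have "(\<lambda>\<epsilon>::real. real j * \<epsilon>\<^sup>2) \<in> O[at_right 0](\<lambda>\<epsilon>. \<epsilon>\<^sup>2)" by simp
  ultimately have "(\<lambda>\<epsilon>::real. (1 + \<epsilon>) * ((1 + \<epsilon>) ^ j - 1 - real j * \<epsilon>) + real j * \<epsilon>\<^sup>2)
      \<in> O[at_right 0](\<lambda>\<epsilon>. \<epsilon>\<^sup>2)"
    by (intro sum_in_bigo) simp_all
  then show ?case by (simp add: algebra_simps power2_eq_square)
qed simp

theorem theorem4p3:
  fixes M0 K0 N0 R M K N L :: nat and U V W :: "real mat" and norm_A norm_B :: real
  assumes "bilinear_algorithm M0 K0 N0 R U V W"
    and "0 < M" and "0 < K" and "0 < N"
    and "M0 ^ L dvd M" and "K0 ^ L dvd K" and "N0 ^ L dvd N"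
  shows "\<exists>g :: real \<Rightarrow> real. g \<in> O[at_right 0](\<lambda>\<epsilon>. \<epsilon>\<^sup>2) \<and>
    (\<forall>\<epsilon>>0. \<forall>A \<in> carrier_mat M K. \<forall>B \<in> carrier_mat K N. \<forall>C.
       max_norm A = norm_A \<longrightarrow> max_norm B = norm_B \<longrightarrow>
       fl_recursive_product M0 K0 N0 R U V W \<epsilon> L A B C \<longrightarrow>
       max_norm (C - A * B) \<le>
         (real K / real K0 ^ L + real (prefactor U V W) * real L) * (real K / real K0 ^ L) *
           stability_factor U V W ^ L * max_norm A * max_norm B * \<epsilon> + g \<epsilon>)"
proof -
  obtain m n s where mns: "M = M0 ^ L * m" "K = K0 ^ L * n" "N = N0 ^ L * s"
    using assms(5-7) by (auto elim!: dvdE)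
  define j where "j = prefactor U V W * L + n"
  define F where "F = real n * stability_factor U V W ^ L"
  \<comment> \<open>The exact excess of the closed bound over its linear part. It sees the matrices
    only through their norms, so one \<open>g\<close> serves all inputs with these norms.\<close>
  define g where "g \<epsilon> = F * (norm_A * norm_B) * ((1 + \<epsilon>) ^ j - 1 - real j * \<epsilon>)" for \<epsilon>
  have Kn: "real K / real K0 ^ L = real n"
    using bilinear_algorithmD(2)[OF assms(1)] mns by simp
  have "g \<in> O[at_right 0](\<lambda>\<epsilon>. \<epsilon>\<^sup>2)"
    unfolding g_def by (rule landau_o.big.mult_left[OF power_minus_linear_bigo, THEN landau_o.big_trans]) simp
  moreover have "max_norm (C - A * B) \<le>
      (real K / real K0 ^ L + real (prefactor U V W) * real L) * (real K / real K0 ^ L) *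
        stability_factor U V W ^ L * max_norm A * max_norm B * \<epsilon> + g \<epsilon>"
    if eps: "0 < \<epsilon>" and A: "A \<in> carrier_mat M K" and B: "B \<in> carrier_mat K N"
      and nA: "max_norm A = norm_A" and nB: "max_norm B = norm_B"
      and rec: "fl_recursive_product M0 K0 N0 R U V W \<epsilon> L A B C"
    for \<epsilon> A B C
  proof -
    have C: "C \<in> carrier_mat M N"
      using rec A B by (cases L) (auto simp: fl_classical_product_def)
    have bA: "\<bar>A $$ (x, y)\<bar> \<le> norm_A" if "x < M" "y < K" for x y
      using max_norm_ge[of x A y] A nA that by simp
    have bB: "\<bar>B $$ (x, y)\<bar> \<le> norm_B" if "x < K" "y < N" for x y
      using max_norm_ge[of x B y] B nB that by simp
    \<comment> \<open>Entry (0, 0) exists because \<open>M\<close>, \<open>K\<close>,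
      \<open>N\<close> are positive.\<close>
    have nn: "0 \<le> norm_A" "0 \<le> norm_B"
      using bA[of 0 0] bB[of 0 0] assms(2-4) by auto
    have "max_norm (C - A * B) \<le> F * ((1 + \<epsilon>) ^ j - 1) * (norm_A * norm_B)"
    proof (rule max_norm_le)
      fix x y assume "x < dim_row (C - A * B)" "y < dim_col (C - A * B)"
      then have xy: "x < M" "y < N" using A B by simp_all
      from fl_recursive_product_error[OF assms(1) eps rec, of m n s norm_A norm_B x y, folded mns, OF A B bA bB nn xy]
      show "\<bar>(C - A * B) $$ (x, y)\<bar> \<le> F * ((1 + \<epsilon>) ^ j - 1) * (norm_A * norm_B)"
        using xy A B C by (simp add: F_def j_def)
    qed (use A B assms in auto)
    also have "\<dots> = F * (norm_A * norm_B) * (real j * \<epsilon>) + g \<epsilon>"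
      by (simp add: g_def algebra_simps)
    \<comment> \<open>Here \<open>j = Q * L + n\<close> gives the first factor of the claimed bound,
      and the \<open>n\<close> inside \<open>F\<close> the second.\<close>
    also have "F * (norm_A * norm_B) * (real j * \<epsilon>) =
        (real n + real (prefactor U V W) * real L) * real n *
          stability_factor U V W ^ L * norm_A * norm_B * \<epsilon>"
      by (simp add: F_def j_def algebra_simps)
    finally show ?thesis unfolding Kn nA nB .
  qed
  ultimately show ?thesis by blast
qed

end
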